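(* Let $0<\alpha<1$, $\beta>1$, $L>0$, $k>0$, and let $G$ be a directed, strongly connected and detail-balanced graph with $N$ nodes and adjacency matrix $A=(a_{ij})$; let $\omega=[\omega_1,\dots,\omega_N]^T$ be a vector with $\omega_i>0$ and $\omega_ia_{ij}=\omega_ja_{ji}$ for all $i,j=1,\dots,N$. Consider the multi-agent system, for $x\in[0,L]$, $t\ge 0$, $i=1,\dots,N$, $$y_{i,t}(x,t)=k\,y_{i,xx}(x,t)+u_i(x,t),\qquad y_i(0,t)=y_i(L,t)=0,\qquad y_i(x,0)=y_i^0(x),$$ where each $y_i^0$ is bounded and continuous on $[0,L]$, with controller $$u_i(x,t)=-\sum_{j=1}^{N}a_{ij}\left(\int_0^L\xi_{ij}(x,t)^{2}\,\mathrm{d}x\right)^{\alpha-1}\xi_{ij}(x,t)-\sum_{j=1}^{N}a_{ij}\left(\int_0^L\xi_{ij}(x,t)^{2}\,\mathrm{d}x\right)^{\beta-1}\xi_{ij}(x,t),$$ where $\xi_{ij}(x,t)=y_i(x,t)-y_j(x,t)$. Then the system achieves fixed-time consensus, and the finite terminal time $t^*$ satisfies $$t^*\le T_{\max}:=\frac{1}{C_3(1-\alpha)}+\frac{1}{(N^{1-\beta})^2C_4(\beta-1)},$$ where $$C_3=\left(\frac{2}{\max_{i=1,\dots,N}\omega_i}\,\lambda_\omega(\mathcal L(D))\right)^{\alpha},\qquad C_4=\left(\frac{2}{\max_{i=1,\dots,N}\omega_i}\,\lambda_\omega(\mathcal L(Q))\right)^{\beta},$$ with $D=\left((\omega_ia_{ij})^{1/\alpha}\right)\in\mathbb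 R^{N\times N}$ and $Q=\left((\omega_ia_{ij})^{1/\beta}\right)\in\mathbb R^{N\times N}$.
   Context: Graph: $G=\{\mathfrak V,\mathfrak E,A\}$ has vertices $v_1,\dots,v_N$ and nonnegative adjacency matrix $A=(a_{ij})$, with $a_{ij}>0$ if node $v_i$ can receive data from $v_j$ (i.e. $(v_j,v_i)\in\mathfrak E$, $v_j\in N_i$), and $a_{ij}=0$ otherwise. A directed graph is strongly connected if for any pair $v_i,v_j$ there is a sequence $a_{ii_1},a_{i_1i_2},\dots,a_{i_mj}$ all of whose elements are positive; it is detail-balanced if there is a vector $\omega=[\omega_1,\dots,\omega_N]^T$ with $\omega_i>0$ and $\omega_ia_{ij}=\omega_ja_{ji}$ for all $i,j$. Laplacian: for a nonnegative matrix $M=(m_{ij})$ viewed as an adjacency matrix, $\mathcal L(M)=(l_{ij})$ with $l_{ij}=-m_{ij}$ for $j\neq i$ and $l_{ii}=\sum_{j\ne i}m_{ij}$. For symmetric $\mathcal L(M)$, $\lambda_\omega(\mathcal L(M))=\min_{x\ne0,\ \langle x,\omega\rangle=0}\frac{\langle x,\mathcal L(M)x\rangle}{\langle x,x\rangle}$. Finite-time consensus (FTC): there exists a finite time $t^*$ (the terminal time) such that $\lim_{t\to t^*}|y_i(x,t)-y_j(x,t)|=0$ for any $x\in[0,L]$ and $i,j=1,\dots,N$. Fixed-time consensus (FXC): FTC holds and in addition the terminal time $t^*$ is bounded by a positive constant $T_{\max}$ independent of the initial condition. Subscripts $t$, $xx$ denote partial derivatives. The term $\left(\int_0^L\xi_{ij}^2\,\mathrm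 dx\right)^{\alpha-1}\xi_{ij}$ is read as $0$ when $\xi_{ij}(\cdot,t)\equiv0$ (in particular for $i=j$). *)

theory Defs
  imports "HOL-Analysis.Analysis"
begin

text \<open>
  The nodes are the elements of a finite type \<open>'n\<close>, so N is \<open>CARD('n)\<close>. A weighted digraph is given
  by its nonnegative adjacency matrix: \<open>A $ i $ j > 0\<close> iff there is an edge from j to i, that is,
  iff i receives data from j.
\<close>

definition adjacency_matrix :: "real^'n^'n \<Rightarrow> bool" where
  "adjacency_matrix A \<longleftrightarrow> (\<forall>i j. 0 \<le> A $ i $ j)"

text \<open>
  The reflexive closure only affects the pairs (i, i), for which no path is demanded.
\<close>

definition strongly_connected :: "real^'n^'n \<Rightarrow> bool" where
  "strongly_connected A \<longleftrightarrow> (\<forall>i j. (\<lambda>p q. 0 < A $ p $ q)\<^sup>*\<^sup>* i j)"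

definition detail_balanced_by :: "real^'n^'n \<Rightarrow> real^'n \<Rightarrow> bool" where
  "detail_balanced_by A \<omega> \<longleftrightarrow>
     (\<forall>i. 0 < \<omega> $ i) \<and> (\<forall>i j. \<omega> $ i * A $ i $ j = \<omega> $ j * A $ j $ i)"

definition laplacian :: "real^'n^'n \<Rightarrow> real^'n^'n" where
  "laplacian M = (\<chi> i j. if i = j then (\<Sum>l\<in>UNIV - {i}. M $ i $ l) else - M $ i $ j)"

text \<open>
  \<open>LEAST\<close> is the minimum. It exists for \<open>CARD('n) \<ge> 2\<close>; for a single node there is no admissible x
  and the value is unspecified.
\<close>

definition lambda_restricted :: "real^'n \<Rightarrow> real^'n^'n \<Rightarrow> real" where
  "lambda_restricted \<omega> M =
     (LEAST r. \<exists>x. x \<noteq> 0 \<and> x \<bullet> \<omega> = 0 \<and> r = (x \<bullet> (M *v x)) / (x \<bullet> x))"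

text \<open>
  A trajectory is a function y with \<open>y i x t\<close> the state of agent i at position x and time t.
  Since \<open>0 powr a = 0\<close>, a summand of the controller vanishes if the integral does.
\<close>

definition coupling ::
  "real^'n^'n \<Rightarrow> real \<Rightarrow> real \<Rightarrow> ('n \<Rightarrow> real \<Rightarrow> real \<Rightarrow> real) \<Rightarrow> 'n \<Rightarrow> real \<Rightarrow> real \<Rightarrow> real" where
  "coupling A L \<gamma> y i x t =
     (\<Sum>j\<in>UNIV. A $ i $ j *
        (integral {0..L} (\<lambda>z. (y i z t - y j z t)\<^sup>2)) powr (\<gamma> - 1) * (y i x t - y j x t))"

definition controller ::
  "real^'n^'n \<Rightarrow> real \<Rightarrow> real \<Rightarrow> real \<Rightarrow> ('n \<Rightarrow> real \<Rightarrow> real \<Rightarrow> real) \<Rightarrow> 'n \<Rightarrow> real \<Rightarrow> real \<Rightarrow> real" where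
  "controller A L \<alpha> \<beta> y i x t = - coupling A L \<alpha> y i x t - coupling A L \<beta> y i x t"

text \<open>
  \<open>closed_loop k L \<alpha> \<beta> A y0 y\<close>: y is a solution with initial data y0. The data are only continuous
  and need not vanish at the ends of the interval, so the equation and the boundary conditions are
  imposed for \<open>t > 0\<close>, and y is continuous down to \<open>t = 0\<close> except at the two corners. The
  equation holds classically on \<open>{0..L}\<close>, with one-sided space derivatives at the ends, for all
  positive times outside some closed countable set E, across which y is still continuous. A
  solution that is classical at all positive times has \<open>E = {}\<close>. Exceptional times cannot be
  excluded: for \<open>\<alpha> \<le> 1/2\<close> the controller is discontinuous where a difference of two agents
  vanishes, and y is in general not differentiable in t when consensus is reached (for two agents,
  the L2 norm r of the difference satisfies \<open>r' \<le> - c * r powr (2*\<alpha> - 1)\<close> with \<open>c > 0\<close>).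
\<close>

definition closed_loop ::
  "real \<Rightarrow> real \<Rightarrow> real \<Rightarrow> real \<Rightarrow> real^'n^'n \<Rightarrow>
     ('n \<Rightarrow> real \<Rightarrow> real) \<Rightarrow> ('n \<Rightarrow> real \<Rightarrow> real \<Rightarrow> real) \<Rightarrow> bool" where
  "closed_loop k L \<alpha> \<beta> A y0 y \<longleftrightarrow>
     (\<forall>i. continuous_on {0..L} (y0 i) \<and> bounded (y0 i ` {0..L})) \<and>
     (\<forall>i. \<forall>x\<in>{0..L}. y i x 0 = y0 i x) \<and>
     (\<forall>i. \<forall>t>0. y i 0 t = 0 \<and> y i L t = 0) \<and>
     (\<forall>i. continuous_on ({0..L} \<times> {0..} - {0, L} \<times> {0}) (\<lambda>(x, t). y i x t)) \<and>
     (\<exists>E y_t y_x y_xx. closed E \<and> countable E \<and>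
        (\<forall>i. continuous_on ({0..L} \<times> ({0<..} - E)) (\<lambda>(x, t). y_t i x t)) \<and>
        (\<forall>i. continuous_on ({0..L} \<times> ({0<..} - E)) (\<lambda>(x, t). y_xx i x t)) \<and>
        (\<forall>i. \<forall>x\<in>{0..L}. \<forall>t\<in>{0<..} - E.
           ((\<lambda>s. y i x s) has_real_derivative y_t i x t) (at t) \<and>
           ((\<lambda>z. y i z t) has_real_derivative y_x i x t) (at x within {0..L}) \<and>
           ((\<lambda>z. y_x i z t) has_real_derivative y_xx i x t) (at x within {0..L}) \<and>
           y_t i x t = k * y_xx i x t + controller A L \<alpha> \<beta> y i x t))"

definition terminal_time :: "real \<Rightarrow> ('n \<Rightarrow> real \<Rightarrow> real \<Rightarrow> real) \<Rightarrow> real \<Rightarrow> bool" where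
  "terminal_time L y t' \<longleftrightarrow> 0 \<le> t' \<and>
     (\<forall>x\<in>{0..L}. \<forall>i j. ((\<lambda>t. \<bar>y i x t - y j x t\<bar>) \<longlongrightarrow> 0) (at t' within {0..}))"

text \<open>
  A system is the relation S between initial data and the solutions starting from them.
\<close>

definition finite_time_consensus ::
  "real \<Rightarrow> (('n \<Rightarrow> real \<Rightarrow> real) \<Rightarrow> ('n \<Rightarrow> real \<Rightarrow> real \<Rightarrow> real) \<Rightarrow> bool) \<Rightarrow> bool" where
  "finite_time_consensus L S \<longleftrightarrow> (\<forall>y0 y. S y0 y \<longrightarrow> (\<exists>t'. terminal_time L y t'))"

definition fixed_time_consensus ::
  "real \<Rightarrow> (('n \<Rightarrow> real \<Rightarrow> real) \<Rightarrow> ('n \<Rightarrow> real \<Rightarrow> real \<Rightarrow> real) \<Rightarrow> bool) \<Rightarrow> bool" where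
  "fixed_time_consensus L S \<longleftrightarrow> finite_time_consensus L S \<and>
     (\<exists>T>0. \<forall>y0 y. S y0 y \<longrightarrow> (\<exists>t'. terminal_time L y t' \<and> t' \<le> T))"

end

theory Submission imports Defs begin

text \<open>
  Let \<open>W\<close> be the \<open>L\<^sup>2\<close> energy, weighted by \<open>\<omega>\<close>, of the deviations of the agents from their
  \<open>\<omega>\<close>-weighted mean. By detail balance the controllers cancel in that mean, diffusion only
  decreases \<open>W\<close>, and summation by parts over the graph gives
  \<open>W' \<le> - (\<Sum>i j. \<omega>\<^sub>i a\<^sub>i\<^sub>j P\<^sub>i\<^sub>j powr \<alpha>) - (\<Sum>i j. \<omega>\<^sub>i a\<^sub>i\<^sub>j P\<^sub>i\<^sub>j powr \<beta>)\<close>, where \<open>P\<^sub>i\<^sub>j\<close> is the squared \<open>L\<^sup>2\<close>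
  norm of \<open>y\<^sub>i - y\<^sub>j\<close>. Moving the exponents outside the sums (subadditivity for \<open>\<alpha>\<close>, the power mean
  inequality for \<open>\<beta>\<close>) leaves the quadratic forms of the Laplacians of \<open>D\<close> and \<open>Q\<close>, which the
  restricted eigenvalues bound below by multiples of \<open>W\<close>. Omitting the usual factor 1/2 in \<open>W\<close> is
  what produces exactly the constants \<open>C\<^sub>3\<close> and \<open>C\<^sub>4\<close>. A solution may be unbounded near the corners
  \<open>(0, 0)\<close> and \<open>(L, 0)\<close>, so nothing is known about \<open>W\<close> as \<open>t\<close> tends to 0; this is harmless
  because the extinction time of \<open>W\<close> does not depend on its initial value.
\<close>

section \<open>Power inequalities for finite sums\<close>

text \<open>With \<open>T\<close> the total, each share \<open>f s / T\<close> lies between 0 and 1,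
  where lowering the exponent from 1 to \<open>p\<close> can only increase the value; the shares add
  up to 1.\<close>

lemma powr_sum_subadditive:
  fixes f :: "'a \<Rightarrow> real"
  assumes "\<And>s. s \<in> S \<Longrightarrow> 0 \<le> f s" and "0 < p" and "p \<le> 1"
  shows "(\<Sum>s\<in>S. f s) powr p \<le> (\<Sum>s\<in>S. f s powr p)"
proof (cases "finite S \<and> (\<Sum>s\<in>S. f s) \<noteq> 0")
  \<comment> \<open>Here the sum on the left is 0, for infinite \<open>S\<close> by convention, and
    \<open>0 powr p = 0\<close>.\<close>
  case False
  then show ?thesis by (auto simp: sum_nonneg)
next
  case True
  define T where "T = (\<Sum>s\<in>S. f s)"
  have T: "T > 0"
    using True assms(1) unfolding T_def by (simp add: order_less_le sum_nonneg)
  have "f s / T \<le> f s powr p / T powr p" if "s \<in> S" for s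
  proof -
    have "f s \<le> T"
      unfolding T_def using True that assms(1) by (intro member_le_sum) auto
    then have "(f s / T) powr 1 \<le> (f s / T) powr p"
      using T assms that by (intro powr_mono') auto
    then show ?thesis
      using T assms(1)[OF that] by (simp add: powr_divide)
  qed
  then have "(\<Sum>s\<in>S. f s / T) \<le> (\<Sum>s\<in>S. f s powr p / T powr p)"
    by (intro sum_mono)
  moreover have "(\<Sum>s\<in>S. f s / T) = 1"
    using T unfolding T_def by (simp flip: sum_divide_distrib)
  ultimately have "1 \<le> (\<Sum>s\<in>S. f s powr p) / T powr p"
    by (simp add: sum_divide_distrib)
  then show ?thesis
    using T unfolding T_def[symmetric] by (simp add: field_simps)
qed

text \<open>Young's inequality for \<open>f s\<close> and \<open>m powr (p - 1)\<close>, with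
  conjugate exponents \<open>p\<close> and \<open>p / (p - 1)\<close>, is the tangent line bound for
  \<open>x powr p\<close> at the mean \<open>m\<close>. Summing it over \<open>S\<close> gives
  Jensen's inequality.\<close>

lemma powr_sum_power_mean:
  fixes f :: "'a \<Rightarrow> real"
  assumes "\<And>s. s \<in> S \<Longrightarrow> 0 \<le> f s" and "1 < p"
  shows "real (card S) powr (1 - p) * (\<Sum>s\<in>S. f s) powr p \<le> (\<Sum>s\<in>S. f s powr p)"
proof (cases "finite S \<and> (\<Sum>s\<in>S. f s) \<noteq> 0")
  case False
  then show ?thesis by (auto simp: sum_nonneg)
next
  case True
  define T n m where "T = (\<Sum>s\<in>S. f s)" and "n = real (card S)" and "m = T / n"
  have T: "T > 0"
    using True assms(1) unfolding T_def by (simp add: order_less_le sum_nonneg)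
  have n: "n > 0"
    using True unfolding n_def by (auto simp: card_gt_0_iff)
  have m: "m > 0" using T n by (simp add: m_def)
  have young: "f s * m powr (p - 1) \<le> f s powr p / p + m powr p * (1 - 1 / p)" if "s \<in> S" for s
  proof -
    have "f s * m powr (p - 1)
        \<le> f s powr p / p + (m powr (p - 1)) powr (p / (p - 1)) / (p / (p - 1))"
      using assms that by (intro Youngs_inequality) (auto simp: field_simps)
    moreover have "(p - 1) * (p / (p - 1)) = p" "1 / (p / (p - 1)) = 1 - 1 / p"
      using assms(2) by (simp_all add: field_simps)
    ultimately show ?thesis
      by (metis (no_types) powr_powr times_divide_eq_right mult.right_neutral)
  qed
  have "T * m powr (p - 1) = (\<Sum>s\<in>S. f s * m powr (p - 1))"
    by (simp add: T_def sum_distrib_right)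
  also have "\<dots> \<le> (\<Sum>s\<in>S. f s powr p / p + m powr p * (1 - 1 / p))"
    using young by (intro sum_mono)
  also have "\<dots> = (\<Sum>s\<in>S. f s powr p) / p + n * m powr p * (1 - 1 / p)"
    by (simp add: sum.distrib sum_divide_distrib n_def)
  finally have "T * m powr (p - 1) \<le> \<dots>" .
  moreover have "T * m powr (p - 1) = n * m powr p"
    using m n T by (simp add: powr_diff m_def field_simps)
  ultimately have "n * m powr p / p \<le> (\<Sum>s\<in>S. f s powr p) / p"
    by (simp add: algebra_simps)
  then have "n * m powr p \<le> (\<Sum>s\<in>S. f s powr p)"
    using assms(2) by (simp add: divide_le_cancel)
  moreover have "n * m powr p = n powr (1 - p) * T powr p"
    using T n by (simp add: m_def powr_divide powr_diff)
  ultimately show ?thesis by (simp add: T_def n_def)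
qed

section \<open>Differential inequalities with countably many exceptional times\<close>

text \<open>Stands in for the mean value theorem when the energy is continuous but differentiable
  only off a countable set. An arbitrary null set would not do, as the Cantor function
  shows.\<close>

lemma increment_le_derivative_bound:
  fixes f :: "real \<Rightarrow> real"
  assumes "s \<le> t" and "continuous_on {s..t} f" and "countable E"
    and deriv: "\<And>x. x \<in> {s..t} - E \<Longrightarrow> \<exists>d. (f has_real_derivative d) (at x) \<and> d \<le> c"
  shows "f t - f s \<le> c * (t - s)"
proof -
  \<comment> \<open>If \<open>f x - (c + e) * x\<close> increased, it would pass through uncountably many levels, hence through
    one not attained on \<open>E\<close>; at the last point where that level is reached the derivative is
    negative, a contradiction.\<close>
  have *: "f t - f s \<le> (c + e) * (t - s)" if "e > 0" for e
  proof (rule ccontr)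
    define g where "g x = f x - (c + e) * x" for x
    assume "\<not> f t - f s \<le> (c + e) * (t - s)"
    then have "g s < g t" by (simp add: g_def algebra_simps)
    then have "uncountable {g s<..<g t}" by (simp add: uncountable_open_interval)
    with \<open>countable E\<close> have "\<not> {g s<..<g t} \<subseteq> g ` E"
      by (meson countable_image countable_subset)
    then obtain y where y: "g s < y" "y < g t" "y \<notin> g ` E"
      by (meson greaterThanLessThan_iff subsetI)
    define S where "S = {x \<in> {s..t}. g x \<le> y}"
    have contg: "continuous_on {s..t} g"
      unfolding g_def by (intro continuous_intros assms(2))
    have "closed S"
      unfolding S_def by (intro continuous_on_closed_Collect_le contg) auto
    moreover have "bounded S"
      by (rule bounded_subset[OF bounded_closed_interval[of s t]]) (auto simp: S_def)
    ultimately have "compact S"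
      by (simp add: compact_eq_bounded_closed)
    moreover have "S \<noteq> {}" using y assms(1) by (auto simp: S_def)
    ultimately obtain x where x: "x \<in> S" and max: "\<And>z. z \<in> S \<Longrightarrow> z \<le> x"
      using compact_attains_sup[of S] by metis
    have st: "s \<le> x" "x < t" and "g x \<le> y"
      using x y(2) by (auto simp: S_def order_le_less)
    have "g x = y"
    proof (rule ccontr)
      assume "g x \<noteq> y"
      moreover have "continuous_on {x..t} g"
        using st by (intro continuous_on_subset[OF contg]) auto
      ultimately obtain z where "x \<le> z" "z \<le> t" "g z = y"
        using IVT'[of g x y t] \<open>g x \<le> y\<close> y st by auto
      moreover from this have "z \<le> x" using max st by (auto simp: S_def)
      ultimately show False using \<open>g x \<noteq> y\<close> by simp
    qed
    then have "x \<in> {s..t} - E" using y(3) st by auto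
    then obtain d where d: "(f has_real_derivative d) (at x)" "d \<le> c"
      using deriv by blast
    have "(g has_real_derivative d - (c + e)) (at x)"
      unfolding g_def by (auto intro!: derivative_eq_intros d)
    then obtain \<delta> where \<delta>: "\<delta> > 0" "\<And>h. 0 < h \<Longrightarrow> h < \<delta> \<Longrightarrow> g (x + h) < g x"
      using DERIV_neg_dec_right[of g "d - (c + e)" x] d(2) \<open>e > 0\<close> by auto
    define h where "h = min (\<delta> / 2) (t - x)"
    have "0 < h" "h < \<delta>" "x + h \<le> t" using \<delta> st by (auto simp: h_def)
    then have "x + h \<in> S" using \<delta>(2)[of h] \<open>g x = y\<close> st by (auto simp: S_def)
    then show False using max \<open>0 < h\<close> by fastforce
  qed
  show ?thesis
  proof (rule field_le_epsilon)
    fix e :: real assume "e > 0"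
    show "f t - f s \<le> c * (t - s) + e"
    proof (cases "s = t")
      case False
      with assms(1) have "s < t" by simp
      then have "(c + e / (t - s)) * (t - s) = c * (t - s) + e"
        by (simp add: distrib_right)
      with *[of "e / (t - s)"] \<open>e > 0\<close> \<open>s < t\<close> show ?thesis by simp
    qed (use \<open>e > 0\<close> in simp)
  qed
qed

text \<open>
  No assumption is made on \<open>W\<close> near 0: the superlinear term alone brings \<open>W\<close> below 1
  within time \<open>1 / (b * (\<beta> - 1))\<close>, however large it is at first.
\<close>

lemma fixed_time_extinction:
  fixes W :: "real \<Rightarrow> real"
  assumes "0 < a" "0 < b" "\<alpha> < 1" "1 < \<beta>"
    and cont: "continuous_on {0<..} W" and nonneg: "\<And>t. 0 < t \<Longrightarrow> 0 \<le> W t"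
    and E: "countable E"
    and deriv: "\<And>t. 0 < t \<Longrightarrow> t \<notin> E \<Longrightarrow>
      \<exists>d. (W has_real_derivative d) (at t) \<and> d \<le> - a * W t powr \<alpha> - b * W t powr \<beta>"
  shows "W (1 / (a * (1 - \<alpha>)) + 1 / (b * (\<beta> - 1))) = 0"
proof (rule ccontr)
  define T2 T where "T2 = 1 / (b * (\<beta> - 1))" and "T = 1 / (a * (1 - \<alpha>)) + T2"
  assume "W (1 / (a * (1 - \<alpha>)) + 1 / (b * (\<beta> - 1))) \<noteq> 0"
  then have "W T \<noteq> 0" by (simp add: T_def T2_def)
  have T2: "0 < T2" "T2 < T" using assms(1-4) by (auto simp: T2_def T_def)
  \<comment> \<open>\<open>W\<close> is nonincreasing, so a nonzero value at \<open>T\<close> forces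
    positivity at all earlier times; this makes all real powers of \<open>W\<close> differentiable
    wherever \<open>W\<close> is.\<close>
  have pos: "0 < W t" if "0 < t" "t \<le> T" for t
  proof -
    have "W T - W t \<le> 0 * (T - t)"
    proof (rule increment_le_derivative_bound[OF that(2) _ E])
      show "continuous_on {t..T} W"
        using that by (intro continuous_on_subset[OF cont]) auto
      fix x assume "x \<in> {t..T} - E"
      then have "0 < x" "x \<notin> E" using that by auto
      then obtain d where "(W has_real_derivative d) (at x)"
          "d \<le> - a * W x powr \<alpha> - b * W x powr \<beta>"
        using deriv by blast
      moreover have "0 \<le> a * W x powr \<alpha> + b * W x powr \<beta>"
        using assms(1,2) by (intro add_nonneg_nonneg mult_nonneg_nonneg) auto
      ultimately show "\<exists>d. (W has_real_derivative d) (at x) \<and> d \<le> 0"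
        by (intro exI[of _ d]) auto
    qed
    with nonneg[of T] \<open>W T \<noteq> 0\<close> T2 show ?thesis by simp
  qed
  have powr_deriv: "\<exists>d. ((\<lambda>t. W t powr p) has_real_derivative p * W t powr (p - 1) * d) (at t)
      \<and> d \<le> - a * W t powr \<alpha> - b * W t powr \<beta>"
    if t: "0 < t" "t \<le> T" "t \<notin> E" for p t
  proof -
    obtain d where d: "(W has_real_derivative d) (at t)" "d \<le> - a * W t powr \<alpha> - b * W t powr \<beta>"
      using deriv[OF t(1,3)] by auto
    show ?thesis
      using DERIV_chain2[OF has_real_derivative_powr[OF pos[OF t(1,2)], of p] d(1)] d(2)
      by blast
  qed
  have cont_powr: "continuous_on {s..t} (\<lambda>t. W t powr p)" if "0 < s" "t \<le> T" for s t p
  proof -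
    have "\<forall>x\<in>{s..t}. W x \<noteq> 0"
    proof
      fix x assume "x \<in> {s..t}"
      then have "0 < W x" using that by (intro pos) auto
      then show "W x \<noteq> 0" by simp
    qed
    moreover have "continuous_on {s..t} W"
      using that by (intro continuous_on_subset[OF cont]) auto
    ultimately show ?thesis by (intro continuous_intros) auto
  qed
  \<comment> \<open>The power \<open>W powr (1 - \<beta>)\<close> grows at rate at least
    \<open>b * (\<beta> - 1)\<close>, and \<open>T2\<close> is the time it needs to grow by 1. Its
    value at \<open>s\<close> is nonnegative and gets dropped, so no bound on \<open>W s\<close>
    enters. Letting \<open>s\<close> tend to 0 then yields \<open>W T2 \<le> 1\<close>.\<close>
  have "1 - b * (\<beta> - 1) * s \<le> W T2 powr (1 - \<beta>)" if "0 < s" "s < T2" for s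
  proof -
    \<comment> \<open>The sign is reversed because \<open>increment_le_derivative_bound\<close> only
      bounds increments from above.\<close>
    have "- (W T2 powr (1 - \<beta>)) - - (W s powr (1 - \<beta>)) \<le> - (b * (\<beta> - 1)) * (T2 - s)"
    proof (rule increment_le_derivative_bound[OF _ _ E])
      show "s \<le> T2" using that by simp
      show "continuous_on {s..T2} (\<lambda>t. - (W t powr (1 - \<beta>)))"
        using that T2 by (intro continuous_intros cont_powr) auto
      fix x assume x: "x \<in> {s..T2} - E"
      then have x': "0 < x" "x \<le> T" "x \<notin> E" using that T2 by auto
      obtain d where d: "((\<lambda>t. W t powr (1 - \<beta>)) has_real_derivative
            (1 - \<beta>) * W x powr (1 - \<beta> - 1) * d) (at x)"
          "d \<le> - a * W x powr \<alpha> - b * W x powr \<beta>"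
        using powr_deriv[OF x', of "1 - \<beta>"] by blast
      have "d \<le> - b * W x powr \<beta>"
        using d(2) assms(1) by (smt (verit) mult_nonneg_nonneg powr_ge_zero mult_minus_left)
      then have "(\<beta> - 1) * W x powr (- \<beta>) * d \<le> (\<beta> - 1) * W x powr (- \<beta>) * (- b * W x powr \<beta>)"
        using assms(4) by (intro mult_left_mono) auto
      also have "\<dots> = - (b * (\<beta> - 1))"
        using pos[OF x'(1,2)] by (simp add: powr_minus field_simps)
      finally have le: "(\<beta> - 1) * W x powr (- \<beta>) * d \<le> - (b * (\<beta> - 1))" .
      show "\<exists>d. ((\<lambda>t. - (W t powr (1 - \<beta>))) has_real_derivative d) (at x)
          \<and> d \<le> - (b * (\<beta> - 1))"
        by (rule exI, rule conjI, rule DERIV_minus[OF d(1)]) (use le in \<open>simp add: algebra_simps\<close>)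
    qed
    moreover have "b * (\<beta> - 1) * T2 = 1" using assms(2,4) by (simp add: T2_def)
    ultimately show ?thesis
      by (smt (verit) powr_ge_zero right_diff_distrib mult_minus_left)
  qed
  then have "\<forall>\<^sub>F s in at_right 0. 1 - b * (\<beta> - 1) * s \<le> W T2 powr (1 - \<beta>)"
    using T2(1) by (auto simp: eventually_at_right[OF T2(1)])
  moreover have "((\<lambda>s. 1 - b * (\<beta> - 1) * s) \<longlongrightarrow> 1 - b * (\<beta> - 1) * 0) (at_right 0)"
    by (intro tendsto_intros)
  ultimately have "1 - b * (\<beta> - 1) * 0 \<le> W T2 powr (1 - \<beta>)"
    by (intro tendsto_upperbound) auto
  then have "W T2 \<le> 1"
    using powr_less_mono2_neg[of "1 - \<beta>" 1 "W T2"] assms(4) pos[of T2] T2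
    by fastforce
  then have le1: "W T2 powr (1 - \<alpha>) \<le> 1"
    using assms(3) pos[of T2] T2 by (intro powr_le1) auto
  \<comment> \<open>After \<open>T2\<close> the sublinear term takes over:
    \<open>W powr (1 - \<alpha>)\<close> starts at most at 1 and falls at rate at least
    \<open>a * (1 - \<alpha>)\<close>, so it would lose at least 1 by time \<open>T\<close>, against
    its positivity there.\<close>
  have "W T powr (1 - \<alpha>) - W T2 powr (1 - \<alpha>) \<le> - (a * (1 - \<alpha>)) * (T - T2)"
  proof (rule increment_le_derivative_bound[OF _ _ E])
    show "T2 \<le> T" using T2 by simp
    show "continuous_on {T2..T} (\<lambda>t. W t powr (1 - \<alpha>))"
      using T2 by (intro cont_powr) auto
    fix x assume x: "x \<in> {T2..T} - E"
    then have x': "0 < x" "x \<le> T" "x \<notin> E" using T2 by auto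
    obtain d where d: "((\<lambda>t. W t powr (1 - \<alpha>)) has_real_derivative
          (1 - \<alpha>) * W x powr (1 - \<alpha> - 1) * d) (at x)"
        "d \<le> - a * W x powr \<alpha> - b * W x powr \<beta>"
      using powr_deriv[OF x', of "1 - \<alpha>"] by blast
    have "d \<le> - a * W x powr \<alpha>"
      using d(2) assms(2) by (smt (verit) mult_nonneg_nonneg powr_ge_zero mult_minus_left)
    then have "(1 - \<alpha>) * W x powr (- \<alpha>) * d \<le> (1 - \<alpha>) * W x powr (- \<alpha>) * (- a * W x powr \<alpha>)"
      using assms(3) by (intro mult_left_mono) auto
    also have "\<dots> = - (a * (1 - \<alpha>))"
      using pos[OF x'(1,2)] by (simp add: powr_minus field_simps)
    finally have le: "(1 - \<alpha>) * W x powr (- \<alpha>) * d \<le> - (a * (1 - \<alpha>))" .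
    show "\<exists>d. ((\<lambda>t. W t powr (1 - \<alpha>)) has_real_derivative d) (at x)
        \<and> d \<le> - (a * (1 - \<alpha>))"
      by (rule exI, rule conjI, rule d(1)) (use le in \<open>simp add: algebra_simps\<close>)
  qed
  moreover have "a * (1 - \<alpha>) * (T - T2) = 1" using assms(1,3) by (simp add: T_def)
  moreover have "0 < W T powr (1 - \<alpha>)" using pos[of T] T2 by simp
  ultimately show False using le1 by (smt (verit) mult_minus_left)
qed

section \<open>The quadratic form of the Laplacian and its restricted minimum\<close>

text \<open>Summation by parts on the graph: exchange the two indices and average. It serves both
  the Laplacian, with \<open>f = g\<close>, and the controller, where \<open>f\<close> is the
  deviation from the mean and \<open>g\<close> the state itself.\<close>

lemma symmetric_double_sum:
  fixes b :: "'a \<Rightarrow> 'a \<Rightarrow> real"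
  assumes "\<And>i j. b i j = b j i"
  shows "(\<Sum>i\<in>S. \<Sum>j\<in>S. b i j * (f i * (g i - g j)))
    = (\<Sum>i\<in>S. \<Sum>j\<in>S. b i j * ((f i - f j) * (g i - g j))) / 2"
proof -
  have "(\<Sum>i\<in>S. \<Sum>j\<in>S. b i j * (f i * (g i - g j)))
      = (\<Sum>i\<in>S. \<Sum>j\<in>S. b i j * (f j * (g j - g i)))"
    by (subst sum.swap) (simp add: assms)
  then have "2 * (\<Sum>i\<in>S. \<Sum>j\<in>S. b i j * (f i * (g i - g j)))
      = (\<Sum>i\<in>S. \<Sum>j\<in>S. b i j * (f i * (g i - g j)) + b i j * (f j * (g j - g i)))"
    by (simp add: sum.distrib)
  also have "\<dots> = (\<Sum>i\<in>S. \<Sum>j\<in>S. b i j * ((f i - f j) * (g i - g j)))"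
    by (intro sum.cong refl) (simp add: algebra_simps)
  finally show ?thesis by simp
qed

lemma laplacian_quadratic_form:
  fixes M :: "real^'n^'n"
  assumes "\<And>i j. M $ i $ j = M $ j $ i"
  shows "x \<bullet> (laplacian M *v x) = (\<Sum>i\<in>UNIV. \<Sum>j\<in>UNIV. M $ i $ j * (x $ i - x $ j)\<^sup>2) / 2"
proof -
  have "(laplacian M *v x) $ i = (\<Sum>j\<in>UNIV. M $ i $ j * (x $ i - x $ j))" for i
  proof -
    have "(laplacian M *v x) $ i = (\<Sum>j\<in>UNIV. laplacian M $ i $ j * x $ j)"
      by (simp add: matrix_vector_mult_def)
    also have "\<dots> = laplacian M $ i $ i * x $ i + (\<Sum>j\<in>UNIV - {i}. laplacian M $ i $ j * x $ j)"
      by (simp add: sum.remove[of UNIV i])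
    also have "(\<Sum>j\<in>UNIV - {i}. laplacian M $ i $ j * x $ j) = (\<Sum>j\<in>UNIV - {i}. - M $ i $ j * x $ j)"
      by (intro sum.cong) (auto simp: laplacian_def)
    also have "laplacian M $ i $ i * x $ i + \<dots> = (\<Sum>j\<in>UNIV - {i}. M $ i $ j * (x $ i - x $ j))"
      by (simp add: laplacian_def sum_distrib_right sum_subtractf sum_negf right_diff_distrib)
    \<comment> \<open>A self-loop \<open>M $ i $ i\<close> is multiplied by 0, so the excluded index
      may be restored.\<close>
    also have "\<dots> = (\<Sum>j\<in>UNIV. M $ i $ j * (x $ i - x $ j))"
      by (simp add: sum.remove[of UNIV i])
    finally show ?thesis .
  qed
  then have "x \<bullet> (laplacian M *v x)
      = (\<Sum>i\<in>UNIV. \<Sum>j\<in>UNIV. M $ i $ j * (x $ i * (x $ i - x $ j)))"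
    by (simp add: inner_vec_def sum_distrib_left mult.left_commute)
  also have "\<dots> = (\<Sum>i\<in>UNIV. \<Sum>j\<in>UNIV. M $ i $ j * (x $ i - x $ j)\<^sup>2) / 2"
    using symmetric_double_sum[where b = "\<lambda>i j. M $ i $ j" and S = UNIV and f = "($) x" and g = "($) x"]
      assms
    by (simp add: power2_eq_square)
  finally show ?thesis .
qed

text \<open>The quotient is invariant under scaling, so it may be minimised over the unit vectors
  orthogonal to \<omega>, a compact set. The witness \<open>z\<close> makes this set nonempty, so
  that \<open>LEAST\<close> denotes a true minimum.\<close>

lemma lambda_restricted_attained:
  fixes \<omega> z :: "real^'n" and M :: "real^'n^'n"
  assumes "z \<noteq> 0" and "z \<bullet> \<omega> = 0"
  obtains x where "x \<noteq> 0" "x \<bullet> \<omega> = 0" "lambda_restricted \<omega> M = (x \<bullet> (M *v x)) / (x \<bullet> x)"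
    and "\<And>y. y \<noteq> 0 \<Longrightarrow> y \<bullet> \<omega> = 0 \<Longrightarrow> lambda_restricted \<omega> M \<le> (y \<bullet> (M *v y)) / (y \<bullet> y)"
proof -
  define S where "S = sphere 0 1 \<inter> {x. \<omega> \<bullet> x = 0}"
  have unit: "(1 / norm y) *\<^sub>R y \<in> S" if "y \<noteq> 0" "y \<bullet> \<omega> = 0" for y
    using that by (simp add: S_def inner_commute)
  have "compact S"
    unfolding S_def by (intro compact_Int_closed compact_sphere closed_hyperplane)
  moreover have "S \<noteq> {}" using unit[OF assms] by blast
  moreover have "continuous_on S (\<lambda>x. x \<bullet> (M *v x))"
    by (intro continuous_intros matrix_vector_mult_linear_continuous_on)
  ultimately obtain x where x: "x \<in> S" and min: "\<And>y. y \<in> S \<Longrightarrow> x \<bullet> (M *v x) \<le> y \<bullet> (M *v y)"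
    using continuous_attains_inf[of S "\<lambda>x. x \<bullet> (M *v x)"] by metis
  have x': "x \<noteq> 0" "x \<bullet> \<omega> = 0" "x \<bullet> x = 1"
    using x by (auto simp: S_def inner_commute norm_eq_1)
  have le: "(x \<bullet> (M *v x)) / (x \<bullet> x) \<le> (y \<bullet> (M *v y)) / (y \<bullet> y)"
    if "y \<noteq> 0" "y \<bullet> \<omega> = 0" for y
    using min[OF unit[OF that]] x'(3)
    by (simp add: matrix_vector_mult_scaleR dot_square_norm power2_eq_square)
  have "lambda_restricted \<omega> M = (x \<bullet> (M *v x)) / (x \<bullet> x)"
    unfolding lambda_restricted_def by (rule Least_equality) (use x' le in blast)+
  with x' le show ?thesis by (intro that[of x]) auto
qed

lemma lambda_restricted_le:
  fixes \<omega> x :: "real^'n"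
  assumes "x \<bullet> \<omega> = 0"
  shows "lambda_restricted \<omega> M * (x \<bullet> x) \<le> x \<bullet> (M *v x)"
proof (cases "x = 0")
  case False
  then have "lambda_restricted \<omega> M \<le> (x \<bullet> (M *v x)) / (x \<bullet> x)"
    using lambda_restricted_attained[OF False assms, of M] assms by metis
  with False show ?thesis by (simp add: pos_le_divide_eq)
qed simp

text \<open>If the quadratic form vanished at a minimiser, the minimiser would be constant along
  edges, hence constant by strong connectivity; but a constant vector orthogonal to the positive
  \<omega> is 0.\<close>

lemma lambda_restricted_laplacian_pos:
  fixes \<omega> z :: "real^'n" and M :: "real^'n^'n"
  assumes sym: "\<And>i j. M $ i $ j = M $ j $ i"
    and M: "adjacency_matrix M" "strongly_connected M"
    and \<omega>: "\<And>i. 0 < \<omega> $ i" and z: "z \<noteq> 0" "z \<bullet> \<omega> = 0"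
  shows "0 < lambda_restricted \<omega> (laplacian M)"
proof -
  obtain x where x: "x \<noteq> 0" "x \<bullet> \<omega> = 0"
      "lambda_restricted \<omega> (laplacian M) = (x \<bullet> (laplacian M *v x)) / (x \<bullet> x)"
    using lambda_restricted_attained[OF z] by metis
  define s where "s = (\<Sum>i\<in>UNIV. \<Sum>j\<in>UNIV. M $ i $ j * (x $ i - x $ j)\<^sup>2)"
  have nonneg: "0 \<le> M $ i $ j * (x $ i - x $ j)\<^sup>2" for i j
    using M(1) by (simp add: adjacency_matrix_def)
  have "s \<noteq> 0"
  proof
    assume "s = 0"
    then have zero: "M $ i $ j * (x $ i - x $ j)\<^sup>2 = 0" for i j
      using nonneg by (simp add: s_def sum_nonneg_eq_0_iff sum_nonneg)
    have "x $ i = x $ j" for i j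
    proof -
      have "(\<lambda>p q. 0 < M $ p $ q)\<^sup>*\<^sup>* i j" using M(2) by (simp add: strongly_connected_def)
      then show ?thesis
        by (induction rule: rtranclp_induct) (use zero in force)+
    qed
    then obtain c where c: "\<And>i. x $ i = c" by metis
    then have "c * (\<Sum>i\<in>UNIV. \<omega> $ i) = 0"
      using x(2) by (simp add: inner_vec_def sum_distrib_left)
    moreover have "0 < (\<Sum>i\<in>UNIV. \<omega> $ i)" using \<omega> by (simp add: sum_pos)
    ultimately have "x = 0" using c by (simp add: vec_eq_iff)
    with x(1) show False by simp
  qed
  moreover have "0 \<le> s" unfolding s_def by (intro sum_nonneg nonneg)
  ultimately have "0 < s" by simp
  moreover have "x \<bullet> (laplacian M *v x) = s / 2"
    unfolding s_def by (rule laplacian_quadratic_form[OF sym])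
  ultimately show ?thesis using x by simp
qed

section \<open>Diffusion, deviations from the weighted mean, and pair energies\<close>

text \<open>Integration by parts: the boundary terms vanish, leaving minus the integral of the
  square of \<open>f'\<close>.\<close>

lemma integral_mult_second_derivative_nonpos:
  fixes f f' f'' :: "real \<Rightarrow> real"
  assumes "a \<le> b" and "f a = 0" and "f b = 0" and cont: "continuous_on {a..b} f''"
    and f: "\<And>x. x \<in> {a..b} \<Longrightarrow> (f has_real_derivative f' x) (at x within {a..b})"
    and f': "\<And>x. x \<in> {a..b} \<Longrightarrow> (f' has_real_derivative f'' x) (at x within {a..b})"
  shows "integral {a..b} (\<lambda>x. f x * f'' x) \<le> 0"
proof -
  have cont_f: "continuous_on {a..b} f" "continuous_on {a..b} f'"
    by (rule DERIV_continuous_on[OF f], assumption) (rule DERIV_continuous_on[OF f'])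
  have "((\<lambda>x. f x * f'' x + f' x * f' x) has_integral f b * f' b - f a * f' a) {a..b}"
  proof (rule fundamental_theorem_of_calculus[OF assms(1)])
    fix x assume "x \<in> {a..b}"
    then show "((\<lambda>x. f x * f' x) has_vector_derivative f x * f'' x + f' x * f' x) (at x within {a..b})"
      unfolding has_real_derivative_iff_has_vector_derivative[symmetric]
      by (intro DERIV_mult' f f')
  qed
  moreover have "((\<lambda>x. f' x * f' x) has_integral integral {a..b} (\<lambda>x. f' x * f' x)) {a..b}"
    by (intro integrable_integral integrable_continuous_real continuous_intros cont_f)
  ultimately have "((\<lambda>x. f x * f'' x + f' x * f' x - f' x * f' x) has_integral
      f b * f' b - f a * f' a - integral {a..b} (\<lambda>x. f' x * f' x)) {a..b}"
    by (rule has_integral_diff)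
  then have "((\<lambda>x. f x * f'' x) has_integral - integral {a..b} (\<lambda>x. f' x * f' x)) {a..b}"
    using assms(2,3) by simp
  moreover have "0 \<le> integral {a..b} (\<lambda>x. f' x * f' x)"
    by (intro integral_nonneg integrable_continuous_real continuous_intros cont_f) simp
  ultimately show ?thesis by (simp add: integral_unique)
qed

text \<open>Subtracting the \<omega>-weighted mean, rather than the plain one, makes the vector of
  deviations orthogonal to \<omega>, which is the constraint in
  \<open>lambda_restricted\<close>.\<close>

definition disagreement :: "real^'n \<Rightarrow> ('n \<Rightarrow> real) \<Rightarrow> 'n \<Rightarrow> real" where
  "disagreement \<omega> v i = v i - (\<Sum>j\<in>UNIV. \<omega> $ j * v j) / (\<Sum>j\<in>UNIV. \<omega> $ j)"

lemma disagreement_diff: "disagreement \<omega> v i - disagreement \<omega> v j = v i - v j"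
  by (simp add: disagreement_def)

lemma sum_weighted_disagreement:
  assumes "(\<Sum>j\<in>UNIV. \<omega> $ j) \<noteq> 0"
  shows "(\<Sum>i\<in>UNIV. \<omega> $ i * disagreement \<omega> v i) = 0"
proof -
  have "(\<Sum>i\<in>UNIV. \<omega> $ i * disagreement \<omega> v i)
      = (\<Sum>i\<in>UNIV. \<omega> $ i * v i) - (\<Sum>i\<in>UNIV. \<omega> $ i) * ((\<Sum>j\<in>UNIV. \<omega> $ j * v j) / (\<Sum>j\<in>UNIV. \<omega> $ j))"
    by (simp only: disagreement_def right_diff_distrib sum_subtractf sum_distrib_right)
  with assms show ?thesis by simp
qed

text \<open>The mean of \<open>w\<close> is paired with the weighted sum of the deviations of
  \<open>v\<close>, which is 0. Thus means can be removed from, or inserted into, the second factor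
  at will.\<close>

lemma sum_weighted_disagreement_mult:
  assumes "(\<Sum>j\<in>UNIV. \<omega> $ j) \<noteq> 0"
  shows "(\<Sum>i\<in>UNIV. \<omega> $ i * (disagreement \<omega> v i * disagreement \<omega> w i))
    = (\<Sum>i\<in>UNIV. \<omega> $ i * (disagreement \<omega> v i * w i))"
proof -
  define m where "m = (\<Sum>j\<in>UNIV. \<omega> $ j * w j) / (\<Sum>j\<in>UNIV. \<omega> $ j)"
  have "(\<Sum>i\<in>UNIV. \<omega> $ i * (disagreement \<omega> v i * disagreement \<omega> w i))
      = (\<Sum>i\<in>UNIV. \<omega> $ i * (disagreement \<omega> v i * w i)) - (\<Sum>i\<in>UNIV. \<omega> $ i * disagreement \<omega> v i) * m"
    unfolding sum_distrib_right sum_subtractf[symmetric]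
    by (intro sum.cong refl) (simp add: disagreement_def[of \<omega> w] m_def algebra_simps)
  then show ?thesis using sum_weighted_disagreement[OF assms] by simp
qed

lemma continuous_on_disagreement [continuous_intros]:
  assumes "\<And>i. continuous_on S (\<lambda>p. v p i)"
  shows "continuous_on S (\<lambda>p. disagreement \<omega> (v p) i)"
  \<comment> \<open>If the weights sum to 0, division by zero turns the mean into 0.\<close>
  unfolding disagreement_def by (cases "(\<Sum>j\<in>UNIV. \<omega> $ j) = 0") (auto intro!: continuous_intros assms)

lemma disagreement_has_real_derivative [derivative_intros]:
  assumes "\<And>i. ((\<lambda>t. v t i) has_real_derivative v' i) (at x within S)"
  shows "((\<lambda>t. disagreement \<omega> (v t) i) has_real_derivative disagreement \<omega> v' i) (at x within S)"
  unfolding disagreement_def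
  by (intro DERIV_diff DERIV_cdivide DERIV_sum DERIV_cmult assms)

definition disagreement_energy :: "real^'n \<Rightarrow> real \<Rightarrow> ('n \<Rightarrow> real \<Rightarrow> real) \<Rightarrow> real" where
  "disagreement_energy \<omega> L v =
     integral {0..L} (\<lambda>x. \<Sum>i\<in>UNIV. \<omega> $ i * (disagreement \<omega> (\<lambda>j. v j x) i)\<^sup>2)"

definition pair_energy :: "real \<Rightarrow> ('n \<Rightarrow> real \<Rightarrow> real) \<Rightarrow> 'n \<Rightarrow> 'n \<Rightarrow> real" where
  "pair_energy L v i j = integral {0..L} (\<lambda>x. (v i x - v j x)\<^sup>2)"

lemma pair_energy_commute: "pair_energy L v i j = pair_energy L v j i"
  by (simp add: pair_energy_def power2_commute)

lemma pair_energy_nonneg: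
  assumes "\<And>i. continuous_on {0..L} (v i)"
  shows "0 \<le> pair_energy L v i j"
  unfolding pair_energy_def
  by (intro integral_nonneg integrable_continuous_real continuous_intros assms) simp

definition dissipation ::
  "real^'n \<Rightarrow> real^'n^'n \<Rightarrow> real \<Rightarrow> real \<Rightarrow> ('n \<Rightarrow> real \<Rightarrow> real) \<Rightarrow> real" where
  "dissipation \<omega> A L \<gamma> v =
     (\<Sum>i\<in>UNIV. \<Sum>j\<in>UNIV. \<omega> $ i * A $ i $ j * pair_energy L v i j powr \<gamma>)"

text \<open>The integrals inside \<open>coupling\<close> do not depend on \<open>x\<close>, so they
  act as constant edge weights \<open>b i j\<close>, symmetric by detail balance. Summation by parts
  produces a factor 1/2 that cancels the 2 from differentiating a square, and integrating the
  squared differences supplies the missing factor of \<open>P i j powr \<gamma>\<close>.\<close>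

lemma integral_coupling:
  assumes "detail_balanced_by A \<omega>" and cont: "\<And>i. continuous_on {0..L} (\<lambda>x. y i x t)"
  shows "((\<lambda>x. 2 * (\<Sum>i\<in>UNIV. \<omega> $ i * (disagreement \<omega> (\<lambda>j. y j x t) i * coupling A L \<gamma> y i x t)))
    has_integral dissipation \<omega> A L \<gamma> (\<lambda>i x. y i x t)) {0..L}"
proof -
  define P where "P = pair_energy L (\<lambda>i x. y i x t)"
  define b where "b i j = \<omega> $ i * A $ i $ j * P i j powr (\<gamma> - 1)" for i j
  have b_sym: "b i j = b j i" for i j
    using assms(1) by (simp add: b_def P_def pair_energy_commute[of _ _ i] detail_balanced_by_def)
  \<comment> \<open>This includes \<open>P i j = 0\<close> with a negative exponent, since
    \<open>0 powr a = 0\<close> for every \<open>a\<close>.\<close>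
  have P: "P i j powr (\<gamma> - 1) * P i j = P i j powr \<gamma>" for i j
  proof (cases "P i j = 0")
    case False
    then have "0 < P i j"
      using pair_energy_nonneg[of L "\<lambda>i x. y i x t" i j] cont by (simp add: P_def)
    then show ?thesis by (simp add: powr_diff)
  qed simp
  have "2 * (\<Sum>i\<in>UNIV. \<omega> $ i * (disagreement \<omega> (\<lambda>j. y j x t) i * coupling A L \<gamma> y i x t))
      = (\<Sum>i\<in>UNIV. \<Sum>j\<in>UNIV. b i j * (y i x t - y j x t)\<^sup>2)" for x
  proof -
    have "(\<Sum>i\<in>UNIV. \<omega> $ i * (disagreement \<omega> (\<lambda>j. y j x t) i * coupling A L \<gamma> y i x t))
      = (\<Sum>i\<in>UNIV. \<Sum>j\<in>UNIV. b i j * (disagreement \<omega> (\<lambda>j. y j x t) i * (y i x t - y j x t)))"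
      by (simp add: coupling_def b_def P_def pair_energy_def sum_distrib_left mult_ac)
    also have "\<dots> = (\<Sum>i\<in>UNIV. \<Sum>j\<in>UNIV. b i j * (y i x t - y j x t)\<^sup>2) / 2"
      unfolding symmetric_double_sum[where b = b, OF b_sym]
      by (simp add: disagreement_diff power2_eq_square)
    finally show ?thesis by simp
  qed
  moreover have "((\<lambda>x. \<Sum>i\<in>UNIV. \<Sum>j\<in>UNIV. b i j * (y i x t - y j x t)\<^sup>2)
      has_integral (\<Sum>i\<in>UNIV. \<Sum>j\<in>UNIV. b i j * P i j)) {0..L}"
    unfolding P_def pair_energy_def
    by (intro has_integral_sum has_integral_mult_right integrable_integral
        integrable_continuous_real continuous_intros cont) auto
  moreover have "(\<Sum>i\<in>UNIV. \<Sum>j\<in>UNIV. b i j * P i j) = dissipation \<omega> A L \<gamma> (\<lambda>i x. y i x t)"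
    unfolding dissipation_def P_def[symmetric]
    by (simp add: b_def P mult.assoc)
  ultimately show ?thesis by simp
qed

section \<open>Differentiating the energy along a solution\<close>

text \<open>Trajectories take space before time, whereas the theorems on parameter integrals expect
  the parameter, here time, first.\<close>

lemma continuous_on_swap_arguments:
  assumes "continuous_on (S \<times> T) (\<lambda>(x, t). g x t)" and "V \<subseteq> T"
  shows "continuous_on (V \<times> S) (\<lambda>p. g (snd p) (fst p))"
proof -
  have "continuous_on (V \<times> S) (\<lambda>p. case (snd p, fst p) of (x, t) \<Rightarrow> g x t)"
    using assms(2) by (intro continuous_on_compose2[OF assms(1)] continuous_intros) auto
  then show ?thesis by simp
qed

lemma continuous_on_slice:
  assumes "continuous_on (S \<times> T) (\<lambda>(x, t). g x t)" and "t \<in> T"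
  shows "continuous_on S (\<lambda>x. g x t)"
proof -
  have "continuous_on S (\<lambda>x. case (x, t) of (x, t) \<Rightarrow> g x t)"
    using assms(2) by (intro continuous_on_compose2[OF assms(1)] continuous_intros) auto
  then show ?thesis by simp
qed

text \<open>Differentiation under the integral splits the rate into a diffusion part, nonpositive by
  integration by parts, and the two controller parts, evaluated by
  \<open>integral_coupling\<close>.\<close>

lemma disagreement_energy_has_derivative:
  fixes A :: "real^'n^'n"
  assumes "0 < L" and "0 < k" and bal: "detail_balanced_by A \<omega>"
    and U: "open U" "t \<in> U"
    and bc: "\<And>i. y i 0 t = 0" "\<And>i. y i L t = 0"
    and cont: "\<And>i. continuous_on ({0..L} \<times> U) (\<lambda>(x, t). y i x t)"
    and cont_t: "\<And>i. continuous_on ({0..L} \<times> U) (\<lambda>(x, t). y_t i x t)"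
    and cont_xx: "\<And>i. continuous_on ({0..L} \<times> U) (\<lambda>(x, t). y_xx i x t)"
    and deriv_t: "\<And>i x t. x \<in> {0..L} \<Longrightarrow> t \<in> U \<Longrightarrow>
      ((\<lambda>s. y i x s) has_real_derivative y_t i x t) (at t)"
    and deriv_x: "\<And>i x. x \<in> {0..L} \<Longrightarrow>
      ((\<lambda>z. y i z t) has_real_derivative y_x i x t) (at x within {0..L})"
    and deriv_xx: "\<And>i x. x \<in> {0..L} \<Longrightarrow>
      ((\<lambda>z. y_x i z t) has_real_derivative y_xx i x t) (at x within {0..L})"
    and eq: "\<And>i x. x \<in> {0..L} \<Longrightarrow> y_t i x t = k * y_xx i x t + controller A L \<alpha> \<beta> y i x t"
  shows "\<exists>d. ((\<lambda>t. disagreement_energy \<omega> L (\<lambda>i x. y i x t)) has_real_derivative d) (at t)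
    \<and> d \<le> - dissipation \<omega> A L \<alpha> (\<lambda>i x. y i x t) - dissipation \<omega> A L \<beta> (\<lambda>i x. y i x t)"
proof -
  have \<omega>_pos: "0 < \<omega> $ i" for i using bal by (simp add: detail_balanced_by_def)
  then have \<omega>_sum: "(\<Sum>i\<in>UNIV. \<omega> $ i) \<noteq> 0"
    using sum_pos[of UNIV "($) \<omega>"] by (simp add: less_imp_neq)
  note swap = continuous_on_swap_arguments and slice = continuous_on_slice
  \<comment> \<open>The Leibniz rule is applied on a convex set of times, hence a ball.\<close>
  obtain r where r: "0 < r" "ball t r \<subseteq> U" using U open_contains_ball by metis
  define D where "D s x = (\<Sum>i\<in>UNIV. \<omega> $ i * (2 * (disagreement \<omega> (\<lambda>j. y j x s) i
      * disagreement \<omega> (\<lambda>j. y_t j x s) i)))" for s x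
  have "((\<lambda>s. integral (cbox 0 L) (\<lambda>x. \<Sum>i\<in>UNIV. \<omega> $ i * (disagreement \<omega> (\<lambda>j. y j x s) i)\<^sup>2))
      has_field_derivative integral (cbox 0 L) (D t)) (at t within ball t r)"
  proof (rule leibniz_rule_field_derivative)
    fix s x assume "s \<in> ball t r" "x \<in> cbox 0 L"
    then have *: "s \<in> U" "x \<in> {0..L}" using r by auto
    show "((\<lambda>s. \<Sum>i\<in>UNIV. \<omega> $ i * (disagreement \<omega> (\<lambda>j. y j x s) i)\<^sup>2)
        has_field_derivative D s x) (at s within ball t r)"
      unfolding D_def
      by (auto intro!: derivative_eq_intros has_field_derivative_at_within[OF deriv_t] *
        sum.cong)
  next
    fix s assume "s \<in> ball t r"
    then have "s \<in> U" using r by auto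
    then show "(\<lambda>x. \<Sum>i\<in>UNIV. \<omega> $ i * (disagreement \<omega> (\<lambda>j. y j x s) i)\<^sup>2) integrable_on cbox 0 L"
      by (auto intro!: integrable_continuous_real continuous_intros slice[OF cont])
  next
    show "continuous_on (ball t r \<times> cbox 0 L) (\<lambda>(s, x). D s x)"
      unfolding D_def split_beta interval_cbox[symmetric]
      by (intro continuous_intros swap[OF cont r(2)] swap[OF cont_t r(2)])
  qed (use r in auto)
  then have "((\<lambda>s. disagreement_energy \<omega> L (\<lambda>i x. y i x s)) has_real_derivative
      integral {0..L} (D t)) (at t)"
    using r by (simp add: disagreement_energy_def at_within_open[of t "ball t r"])
  moreover have "integral {0..L} (D t)
      \<le> - dissipation \<omega> A L \<alpha> (\<lambda>i x. y i x t) - dissipation \<omega> A L \<beta> (\<lambda>i x. y i x t)"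
  proof -
    define e where "e i x = disagreement \<omega> (\<lambda>j. y j x t) i" for i x
    define e_xx where "e_xx i x = disagreement \<omega> (\<lambda>j. y_xx j x t) i" for i x
    have conts: "continuous_on {0..L} (e i)" "continuous_on {0..L} (e_xx i)" for i
      unfolding e_def e_xx_def by (intro continuous_intros slice[OF cont] slice[OF cont_xx] U)+
    define I where "I i = integral {0..L} (\<lambda>x. e i x * e_xx i x)" for i
    have "I i \<le> 0" for i
      unfolding I_def
    proof (rule integral_mult_second_derivative_nonpos)
      show "continuous_on {0..L} (e_xx i)" by (rule conts)
      show "e i 0 = 0" "e i L = 0" by (simp_all add: e_def disagreement_def bc)
      fix x assume x: "x \<in> {0..L}"
      show "(e i has_real_derivative disagreement \<omega> (\<lambda>j. y_x j x t) i) (at x within {0..L})"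
        unfolding e_def by (intro derivative_intros deriv_x x)
      show "((\<lambda>x. disagreement \<omega> (\<lambda>j. y_x j x t) i) has_real_derivative e_xx i x) (at x within {0..L})"
        unfolding e_xx_def by (intro derivative_intros deriv_xx x)
    qed (use assms(1) in simp)
    then have nonpos: "2 * k * (\<Sum>i\<in>UNIV. \<omega> $ i * I i) \<le> 0"
      using \<omega>_pos assms(2) by (intro mult_nonneg_nonpos sum_nonpos) (auto simp: less_imp_le)
    let ?c = "\<lambda>\<gamma> x. 2 * (\<Sum>i\<in>UNIV. \<omega> $ i * (e i x * coupling A L \<gamma> y i x t))"
    have D: "D t x = 2 * k * (\<Sum>i\<in>UNIV. \<omega> $ i * (e i x * e_xx i x)) - ?c \<alpha> x - ?c \<beta> x"
      if "x \<in> {0..L}" for x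
    proof -
      have "D t x = 2 * (\<Sum>i\<in>UNIV. \<omega> $ i * (e i x * y_t i x t))"
        using sum_weighted_disagreement_mult[OF \<omega>_sum, of "\<lambda>j. y j x t" "\<lambda>j. y_t j x t"]
        by (simp add: D_def e_def mult.left_commute[of _ 2] flip: sum_distrib_left)
      also have "\<dots> = 2 * k * (\<Sum>i\<in>UNIV. \<omega> $ i * (e i x * y_xx i x t)) - ?c \<alpha> x - ?c \<beta> x"
        unfolding eq[OF that] controller_def sum_distrib_left sum_subtractf[symmetric]
        by (intro sum.cong refl) (simp add: algebra_simps)
      \<comment> \<open>The mean, dropped from \<open>y_t\<close> above, is put back into
        \<open>y_xx\<close>: then \<open>e_xx\<close> is the second space derivative of
        \<open>e\<close>, as integration by parts requires.\<close>
      also have "(\<Sum>i\<in>UNIV. \<omega> $ i * (e i x * y_xx i x t)) = (\<Sum>i\<in>UNIV. \<omega> $ i * (e i x * e_xx i x))"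
        unfolding e_def e_xx_def sum_weighted_disagreement_mult[OF \<omega>_sum] ..
      finally show ?thesis .
    qed
    have "((\<lambda>x. 2 * k * (\<Sum>i\<in>UNIV. \<omega> $ i * (e i x * e_xx i x)) - ?c \<alpha> x - ?c \<beta> x)
        has_integral 2 * k * (\<Sum>i\<in>UNIV. \<omega> $ i * I i) - dissipation \<omega> A L \<alpha> (\<lambda>i x. y i x t)
          - dissipation \<omega> A L \<beta> (\<lambda>i x. y i x t)) {0..L}"
      unfolding I_def e_def
      by (intro has_integral_diff has_integral_mult_right has_integral_sum integral_coupling bal
          slice[OF cont] U integrable_integral integrable_continuous_real continuous_intros
          conts[unfolded e_def]) auto
    then have "integral {0..L} (D t) = 2 * k * (\<Sum>i\<in>UNIV. \<omega> $ i * I i)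
        - dissipation \<omega> A L \<alpha> (\<lambda>i x. y i x t) - dissipation \<omega> A L \<beta> (\<lambda>i x. y i x t)"
      by (intro integral_unique) (simp only: has_integral_cong[OF D])
    with nonpos show ?thesis by simp
  qed
  ultimately show ?thesis by blast
qed

section \<open>Lower bounds for the dissipation\<close>

text \<open>For \<gamma> equal to \<alpha> and \<beta> these are the matrices \<open>D\<close> and
  \<open>Q\<close> of the theorem. The root is taken so that the edge weight can be moved inside a
  power with exponent \<gamma>.\<close>

definition weight_root :: "real^'n \<Rightarrow> real^'n^'n \<Rightarrow> real \<Rightarrow> real^'n^'n" where
  "weight_root \<omega> A \<gamma> = (\<chi> i j. (\<omega> $ i * A $ i $ j) powr (1 / \<gamma>))"

lemma weight_root_symmetric:
  "detail_balanced_by A \<omega> \<Longrightarrow> weight_root \<omega> A \<gamma> $ i $ j = weight_root \<omega> A \<gamma> $ j $ i"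
  by (simp add: weight_root_def detail_balanced_by_def)

lemma adjacency_matrix_weight_root: "adjacency_matrix (weight_root \<omega> A \<gamma>)"
  by (simp add: adjacency_matrix_def weight_root_def)

lemma strongly_connected_weight_root:
  assumes "strongly_connected A" and "\<And>i. 0 < \<omega> $ i"
  shows "strongly_connected (weight_root \<omega> A \<gamma>)"
  unfolding strongly_connected_def
proof (intro allI)
  fix i j
  have "(\<lambda>p q. 0 < A $ p $ q)\<^sup>*\<^sup>* i j" using assms(1) by (simp add: strongly_connected_def)
  moreover have "0 < weight_root \<omega> A \<gamma> $ p $ q" if "0 < A $ p $ q" for p q
    using that assms(2)[of p] by (simp add: weight_root_def)
  ultimately show "(\<lambda>p q. 0 < weight_root \<omega> A \<gamma> $ p $ q)\<^sup>*\<^sup>* i j"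
    by (metis (mono_tags, lifting) mono_rtranclp)
qed

lemma disagreement_energy_nonneg:
  assumes "\<And>i. 0 < \<omega> $ i" and "\<And>i. continuous_on {0..L} (v i)"
  shows "0 \<le> disagreement_energy \<omega> L v"
  unfolding disagreement_energy_def
  by (intro integral_nonneg integrable_continuous_real continuous_intros assms(2) sum_nonneg)
    (simp add: assms(1) less_imp_le)

text \<open>The integrand is continuous and nonnegative on a nondegenerate interval, so a zero
  integral makes it vanish at every point and not just almost everywhere.\<close>

lemma disagreement_energy_eq_0D:
  assumes "\<And>i. 0 < \<omega> $ i" and "\<And>i. continuous_on {0..L} (v i)" and "0 < L"
    and "disagreement_energy \<omega> L v = 0" and "x \<in> {0..L}"
  shows "v i x = v j x"
proof -
  have "(\<Sum>i\<in>UNIV. \<omega> $ i * (disagreement \<omega> (\<lambda>j. v j x) i)\<^sup>2) = 0"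
    using assms(4,5) unfolding disagreement_energy_def
    by (subst (asm) integral_eq_0_iff)
      (auto intro!: continuous_intros assms(2,3) sum_nonneg simp: assms(1) less_imp_le)
  then have "disagreement \<omega> (\<lambda>j. v j x) i = 0" for i
    using assms(1) by (simp add: sum_nonneg_eq_0_iff less_imp_le) (metis less_irrefl)
  then show ?thesis using disagreement_diff[of \<omega> "\<lambda>j. v j x" i j] by simp
qed

lemma Max_weight_pos:
  fixes \<omega> :: "real^'n"
  assumes "\<And>i. 0 < \<omega> $ i"
  shows "0 < (MAX i. \<omega> $ i)"
proof -
  have "\<omega> $ undefined \<le> (MAX i. \<omega> $ i)" by simp
  with assms[of undefined] show ?thesis by linarith
qed

text \<open>The eigenvalue bound is applied to the deviations at each \<open>x\<close> and then
  integrated. The 2 undoes the half in the quadratic form, and the maximum bounds the weights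
  \<omega> that the energy carries but the Euclidean norm does not.\<close>

lemma disagreement_energy_le_pair_energy:
  fixes \<omega> :: "real^'n" and M :: "real^'n^'n"
  assumes sym: "\<And>i j. M $ i $ j = M $ j $ i" and \<omega>: "\<And>i. 0 < \<omega> $ i"
    and cont: "\<And>i. continuous_on {0..L} (v i)"
    and lambda: "0 \<le> lambda_restricted \<omega> (laplacian M)"
  shows "2 / (MAX i. \<omega> $ i) * lambda_restricted \<omega> (laplacian M) * disagreement_energy \<omega> L v
    \<le> (\<Sum>i\<in>UNIV. \<Sum>j\<in>UNIV. M $ i $ j * pair_energy L v i j)"
proof -
  define m where "m = (MAX i. \<omega> $ i)"
  define \<mu> where "\<mu> = lambda_restricted \<omega> (laplacian M)"
  have \<omega>_le: "\<omega> $ i \<le> m" for i by (simp add: m_def)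
  have m: "0 < m" unfolding m_def by (rule Max_weight_pos[OF \<omega>])
  have \<omega>_sum: "(\<Sum>i\<in>UNIV. \<omega> $ i) \<noteq> 0"
    using sum_pos[of UNIV "($) \<omega>"] \<omega> by (simp add: less_imp_neq)
  have pointwise: "2 / m * \<mu> * (\<Sum>i\<in>UNIV. \<omega> $ i * (disagreement \<omega> (\<lambda>j. v j x) i)\<^sup>2)
      \<le> (\<Sum>i\<in>UNIV. \<Sum>j\<in>UNIV. M $ i $ j * (v i x - v j x)\<^sup>2)" for x
  proof -
    define e :: "real^'n" where "e = (\<chi> i. disagreement \<omega> (\<lambda>j. v j x) i)"
    have "e \<bullet> \<omega> = 0"
      using sum_weighted_disagreement[OF \<omega>_sum] by (simp add: e_def inner_vec_def mult.commute)
    then have "\<mu> * (e \<bullet> e) \<le> e \<bullet> (laplacian M *v e)"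
      unfolding \<mu>_def by (rule lambda_restricted_le)
    also have "\<dots> = (\<Sum>i\<in>UNIV. \<Sum>j\<in>UNIV. M $ i $ j * (v i x - v j x)\<^sup>2) / 2"
      by (simp add: laplacian_quadratic_form[OF sym] e_def disagreement_diff)
    finally have "2 * \<mu> * (e \<bullet> e) \<le> (\<Sum>i\<in>UNIV. \<Sum>j\<in>UNIV. M $ i $ j * (v i x - v j x)\<^sup>2)"
      by simp
    moreover have "(\<Sum>i\<in>UNIV. \<omega> $ i * (disagreement \<omega> (\<lambda>j. v j x) i)\<^sup>2) \<le> m * (e \<bullet> e)"
      unfolding inner_vec_def sum_distrib_left
      using \<omega>_le by (intro sum_mono) (simp add: e_def power2_eq_square mult_right_mono)
    then have "2 / m * \<mu> * (\<Sum>i\<in>UNIV. \<omega> $ i * (disagreement \<omega> (\<lambda>j. v j x) i)\<^sup>2)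
        \<le> 2 / m * \<mu> * (m * (e \<bullet> e))"
      using m lambda by (intro mult_left_mono) (auto simp: \<mu>_def)
    moreover have "2 / m * \<mu> * (m * (e \<bullet> e)) = 2 * \<mu> * (e \<bullet> e)" using m by simp
    ultimately show ?thesis by linarith
  qed
  have "((\<lambda>x. 2 / m * \<mu> * (\<Sum>i\<in>UNIV. \<omega> $ i * (disagreement \<omega> (\<lambda>j. v j x) i)\<^sup>2))
      has_integral 2 / m * \<mu> * disagreement_energy \<omega> L v) {0..L}"
    unfolding disagreement_energy_def
    by (intro has_integral_mult_right integrable_integral integrable_continuous_real
        continuous_intros cont)
  moreover have "((\<lambda>x. \<Sum>i\<in>UNIV. \<Sum>j\<in>UNIV. M $ i $ j * (v i x - v j x)\<^sup>2)
      has_integral (\<Sum>i\<in>UNIV. \<Sum>j\<in>UNIV. M $ i $ j * pair_energy L v i j)) {0..L}"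
    unfolding pair_energy_def
    by (intro has_integral_sum has_integral_mult_right integrable_integral
        integrable_continuous_real continuous_intros cont) auto
  ultimately show ?thesis
    unfolding m_def[symmetric] \<mu>_def[symmetric] by (rule has_integral_le) (rule pointwise)
qed

lemma dissipation_eq_sum_powr:
  fixes A :: "real^'n^'n"
  assumes "adjacency_matrix A" and "\<And>i. 0 < \<omega> $ i" and "\<gamma> \<noteq> 0"
    and "\<And>i. continuous_on {0..L} (v i)"
  shows "dissipation \<omega> A L \<gamma> v
    = (\<Sum>(i, j)\<in>UNIV. (weight_root \<omega> A \<gamma> $ i $ j * pair_energy L v i j) powr \<gamma>)"
proof -
  have "\<omega> $ i * A $ i $ j * pair_energy L v i j powr \<gamma>
      = (weight_root \<omega> A \<gamma> $ i $ j * pair_energy L v i j) powr \<gamma>" for i j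
    using assms(1-3) pair_energy_nonneg[of L v i j, OF assms(4)]
    by (simp add: weight_root_def powr_mult powr_powr adjacency_matrix_def less_imp_le)
  then show ?thesis
    by (simp add: dissipation_def sum.cartesian_product flip: UNIV_Times_UNIV)
qed

lemma lambda_restricted_weight_root_pos:
  assumes "detail_balanced_by A \<omega>" and "strongly_connected A" and "z \<noteq> 0" and "z \<bullet> \<omega> = 0"
  shows "0 < lambda_restricted \<omega> (laplacian (weight_root \<omega> A \<gamma>))"
proof -
  have \<omega>: "0 < \<omega> $ i" for i using assms(1) by (simp add: detail_balanced_by_def)
  show ?thesis
    by (rule lambda_restricted_laplacian_pos[OF weight_root_symmetric[OF assms(1)]
        adjacency_matrix_weight_root strongly_connected_weight_root[OF assms(2) \<omega>] \<omega> assms(3,4)])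
qed

text \<open>The dissipation is a single sum of powers over ordered pairs of nodes, so the power
  inequalities move the exponent outside and the eigenvalue bound applies to the base. The square on
  \<open>real CARD('n) powr (1 - \<gamma>)\<close> arises because the power mean runs over all
  pairs, whose number is the square of \<open>CARD('n)\<close>.\<close>

lemma dissipation_ge_energy_powr:
  fixes A :: "real^'n^'n"
  assumes "adjacency_matrix A" and "detail_balanced_by A \<omega>" and "strongly_connected A"
    and "z \<noteq> 0" and "z \<bullet> \<omega> = 0" and cont: "\<And>i. continuous_on {0..L} (v i)"
  defines "C \<equiv> \<lambda>\<gamma>. (2 / (MAX i. \<omega> $ i)
      * lambda_restricted \<omega> (laplacian (weight_root \<omega> A \<gamma>))) powr \<gamma>"
  shows "0 < \<gamma> \<Longrightarrow> \<gamma> < 1 \<Longrightarrow> C \<gamma> * disagreement_energy \<omega> L v powr \<gamma> \<le> dissipation \<omega> A L \<gamma> v"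
    and "1 < \<gamma> \<Longrightarrow> (real CARD('n) powr (1 - \<gamma>))\<^sup>2 * C \<gamma> * disagreement_energy \<omega> L v powr \<gamma>
      \<le> dissipation \<omega> A L \<gamma> v"
proof -
  have \<omega>: "0 < \<omega> $ i" for i using assms(2) by (simp add: detail_balanced_by_def)
  define q where "q \<gamma> = (\<lambda>(i, j). weight_root \<omega> A \<gamma> $ i $ j * pair_energy L v i j)" for \<gamma>
  have q_nonneg: "0 \<le> q \<gamma> p" for \<gamma> p
    using pair_energy_nonneg[of L v, OF cont] by (simp add: q_def weight_root_def split_beta)
  have dissipation: "dissipation \<omega> A L \<gamma> v = (\<Sum>p\<in>UNIV. q \<gamma> p powr \<gamma>)" if "\<gamma> \<noteq> 0" for \<gamma>
    using dissipation_eq_sum_powr[of A \<omega> \<gamma> L v, OF assms(1) \<omega> that cont]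
    by (simp add: q_def split_beta)
  have energy: "C \<gamma> * disagreement_energy \<omega> L v powr \<gamma> \<le> (\<Sum>p\<in>UNIV. q \<gamma> p) powr \<gamma>"
    if "0 < \<gamma>" for \<gamma>
  proof -
    let ?c = "2 / (MAX i. \<omega> $ i) * lambda_restricted \<omega> (laplacian (weight_root \<omega> A \<gamma>))"
    let ?E = "disagreement_energy \<omega> L v"
    have lambda: "0 \<le> lambda_restricted \<omega> (laplacian (weight_root \<omega> A \<gamma>))"
      using lambda_restricted_weight_root_pos[OF assms(2-5)] by (rule less_imp_le)
    then have c: "0 \<le> ?c" using Max_weight_pos[of \<omega>, OF \<omega>] by simp
    have E: "0 \<le> ?E" by (rule disagreement_energy_nonneg[OF \<omega> cont])
    have "?c * ?E \<le> (\<Sum>i\<in>UNIV. \<Sum>j\<in>UNIV. weight_root \<omega> A \<gamma> $ i $ j * pair_energy L v i j)"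
      by (rule disagreement_energy_le_pair_energy[OF weight_root_symmetric[OF assms(2)] \<omega> cont lambda])
    also have "\<dots> = (\<Sum>p\<in>UNIV. q \<gamma> p)"
      by (simp add: q_def sum.cartesian_product flip: UNIV_Times_UNIV)
    finally have "(?c * ?E) powr \<gamma> \<le> (\<Sum>p\<in>UNIV. q \<gamma> p) powr \<gamma>"
      using that by (intro powr_mono2 mult_nonneg_nonneg[OF c E]) auto
    moreover have "(?c * ?E) powr \<gamma> = C \<gamma> * ?E powr \<gamma>"
      unfolding C_def by (rule powr_mult)
    ultimately show ?thesis by simp
  qed
  show "C \<gamma> * disagreement_energy \<omega> L v powr \<gamma> \<le> dissipation \<omega> A L \<gamma> v" if "0 < \<gamma>" "\<gamma> < 1"
    using energy[OF that(1)] powr_sum_subadditive[of UNIV "q \<gamma>" \<gamma>] q_nonneg dissipation[of \<gamma>] that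
    by simp
  show "(real CARD('n) powr (1 - \<gamma>))\<^sup>2 * C \<gamma> * disagreement_energy \<omega> L v powr \<gamma>
      \<le> dissipation \<omega> A L \<gamma> v" if "1 < \<gamma>"
  proof -
    have "real CARD('n \<times> 'n) powr (1 - \<gamma>) = (real CARD('n) powr (1 - \<gamma>))\<^sup>2"
      by (simp add: powr_mult power2_eq_square)
    then have "(real CARD('n) powr (1 - \<gamma>))\<^sup>2 * (\<Sum>p\<in>UNIV. q \<gamma> p) powr \<gamma> \<le> dissipation \<omega> A L \<gamma> v"
      using powr_sum_power_mean[of UNIV "q \<gamma>" \<gamma>] q_nonneg dissipation[of \<gamma>] that by simp
    moreover have "(real CARD('n) powr (1 - \<gamma>))\<^sup>2 * (C \<gamma> * disagreement_energy \<omega> L v powr \<gamma>)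
        \<le> (real CARD('n) powr (1 - \<gamma>))\<^sup>2 * (\<Sum>p\<in>UNIV. q \<gamma> p) powr \<gamma>"
      using energy[of \<gamma>] that by (intro mult_left_mono) auto
    ultimately show ?thesis unfolding mult.assoc by linarith
  qed
qed

section \<open>Consensus of the closed-loop solutions\<close>

lemma closed_loop_continuous:
  assumes "closed_loop k L \<alpha> \<beta> A y0 y"
  shows "continuous_on ({0..L} \<times> {0<..}) (\<lambda>(x, t). y i x t)"
  using assms unfolding closed_loop_def
  by (elim conjE allE[where x = i]) (erule continuous_on_subset, auto)

text \<open>Since \<open>E\<close> is closed, the regular positive times form an open set, on which
  \<open>disagreement_energy_has_derivative\<close> applies.\<close>

lemma closed_loop_energy:
  assumes "0 < L" and "0 < k" and bal: "detail_balanced_by A \<omega>"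
    and cl: "closed_loop k L \<alpha> \<beta> A y0 y"
  obtains E where "countable E"
    and "\<And>t. 0 < t \<Longrightarrow> t \<notin> E \<Longrightarrow>
      \<exists>d. ((\<lambda>t. disagreement_energy \<omega> L (\<lambda>i x. y i x t)) has_real_derivative d) (at t)
        \<and> d \<le> - dissipation \<omega> A L \<alpha> (\<lambda>i x. y i x t) - dissipation \<omega> A L \<beta> (\<lambda>i x. y i x t)"
proof -
  obtain E y_t y_x y_xx where E: "closed E" "countable E"
    and cont: "\<forall>i. continuous_on ({0..L} \<times> ({0<..} - E)) (\<lambda>(x, t). y_t i x t)"
      "\<forall>i. continuous_on ({0..L} \<times> ({0<..} - E)) (\<lambda>(x, t). y_xx i x t)"
    and eq: "\<forall>i. \<forall>x\<in>{0..L}. \<forall>t\<in>{0<..} - E.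
           ((\<lambda>s. y i x s) has_real_derivative y_t i x t) (at t) \<and>
           ((\<lambda>z. y i z t) has_real_derivative y_x i x t) (at x within {0..L}) \<and>
           ((\<lambda>z. y_x i z t) has_real_derivative y_xx i x t) (at x within {0..L}) \<and>
           y_t i x t = k * y_xx i x t + controller A L \<alpha> \<beta> y i x t"
    using cl unfolding closed_loop_def by (elim conjE exE) (rule that)
  have bc: "y i 0 t = 0" "y i L t = 0" if "0 < t" for i t
    using cl that by (auto simp: closed_loop_def)
  show ?thesis
  proof (rule that[OF E(2)])
    fix t :: real assume "0 < t" "t \<notin> E"
    then have t: "t \<in> {0<..} - E" by simp
    show "\<exists>d. ((\<lambda>t. disagreement_energy \<omega> L (\<lambda>i x. y i x t)) has_real_derivative d) (at t)
        \<and> d \<le> - dissipation \<omega> A L \<alpha> (\<lambda>i x. y i x t) - dissipation \<omega> A L \<beta> (\<lambda>i x. y i x t)"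
    proof (rule disagreement_energy_has_derivative[where y = y and y_t = y_t and y_xx = y_xx and y_x = y_x,
        OF assms(1-3) _ t bc[OF \<open>0 < t\<close>] _
        cont[rule_format]])
      show "open ({0<..} - E)" using E(1) by auto
      show "continuous_on ({0..L} \<times> ({0<..} - E)) (\<lambda>(x, t). y i x t)" for i
        by (rule continuous_on_subset[OF closed_loop_continuous[OF cl]]) auto
    qed (use eq t in blast)+
  qed
qed

lemma closed_loop_energy_continuous:
  assumes "closed_loop k L \<alpha> \<beta> A y0 y"
  shows "continuous_on {0<..} (\<lambda>t. disagreement_energy \<omega> L (\<lambda>i x. y i x t))"
  unfolding disagreement_energy_def interval_cbox
  by (intro integral_continuous_on_param)
    (auto simp: split_beta interval_cbox[symmetric] intro!: continuous_intros
      continuous_on_swap_arguments[OF closed_loop_continuous[OF assms]])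

lemma terminal_time_if_agree:
  assumes cl: "closed_loop k L \<alpha> \<beta> A y0 y" and "0 < T"
    and agree: "\<And>i j x. x \<in> {0..L} \<Longrightarrow> y i x T = y j x T"
  shows "terminal_time L y T"
proof -
  have "((\<lambda>t. \<bar>y i x t - y j x t\<bar>) \<longlongrightarrow> 0) (at T within {0..})" if x: "x \<in> {0..L}" for i j x
  proof -
    have "continuous_on {0<..} (\<lambda>t. case (x, t) of (x, t) \<Rightarrow> y i x t)" for i
      using x by (intro continuous_on_compose2[OF closed_loop_continuous[OF cl]] continuous_intros) auto
    then have "continuous_on {0<..} (\<lambda>t. \<bar>y i x t - y j x t\<bar>)"
      by (intro continuous_intros) simp_all
    then have "((\<lambda>t. \<bar>y i x t - y j x t\<bar>) \<longlongrightarrow> \<bar>y i x T - y j x T\<bar>) (at T)"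
      using \<open>0 < T\<close> by (simp add: continuous_on_eq_continuous_at isCont_def)
    then show ?thesis using agree[OF x, of i j] by (auto intro: tendsto_within_subset)
  qed
  with \<open>0 < T\<close> show ?thesis by (simp add: terminal_time_def)
qed

theorem theorem3p4:
  fixes A :: "real^'n^'n" and \<omega> :: "real^'n" and \<alpha> \<beta> L k :: real
  assumes "0 < \<alpha>" and "\<alpha> < 1" and "1 < \<beta>" and "0 < L" and "0 < k"
    and "adjacency_matrix A" and "strongly_connected A" and "detail_balanced_by A \<omega>"
  shows "let N = real CARD('n);
             D = (\<chi> i j. (\<omega> $ i * A $ i $ j) powr (1 / \<alpha>)) :: real^'n^'n;
             Q = (\<chi> i j. (\<omega> $ i * A $ i $ j) powr (1 / \<beta>)) :: real^'n^'n;
             C\<^sub>3 = (2 / (MAX i. \<omega> $ i) * lambda_restricted \<omega> (laplacian D)) powr \<alpha>;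
             C\<^sub>4 = (2 / (MAX i. \<omega> $ i) * lambda_restricted \<omega> (laplacian Q)) powr \<beta>;
             T\<^sub>m\<^sub>a\<^sub>x = 1 / (C\<^sub>3 * (1 - \<alpha>)) + 1 / ((N powr (1 - \<beta>))\<^sup>2 * C\<^sub>4 * (\<beta> - 1))
         in fixed_time_consensus L (closed_loop k L \<alpha> \<beta> A) \<and>
            (\<forall>y0 y. closed_loop k L \<alpha> \<beta> A y0 y \<longrightarrow>
               (\<exists>t'. terminal_time L y t' \<and> t' \<le> T\<^sub>m\<^sub>a\<^sub>x))"
proof -
  define C where "C \<gamma> = (2 / (MAX i. \<omega> $ i)
      * lambda_restricted \<omega> (laplacian (weight_root \<omega> A \<gamma>))) powr \<gamma>" for \<gamma>
  define b where "b = (real CARD('n) powr (1 - \<beta>))\<^sup>2 * C \<beta>"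
  define T where "T = 1 / (C \<alpha> * (1 - \<alpha>)) + 1 / (b * (\<beta> - 1))"
  \<comment> \<open>For a single node the restricted eigenvalues are unspecified, so nothing
    stronger is available; the bound rests on \<open>powr\<close> being nonnegative and on
    \<open>1 / 0 = 0\<close>.\<close>
  have "0 \<le> T"
    using assms(2,3) by (simp add: T_def b_def C_def)
  have \<omega>: "0 < \<omega> $ i" for i using assms(8) by (simp add: detail_balanced_by_def)
  have main: "\<exists>t'. terminal_time L y t' \<and> t' \<le> T" if cl: "closed_loop k L \<alpha> \<beta> A y0 y" for y0 y
  proof (cases "\<exists>i j :: 'n. i \<noteq> j")
    case False
    then have "i = j" for i j :: 'n by blast
    then have "\<bar>y i x t - y j x t\<bar> = 0" for i j x t by (metis diff_self abs_zero)
    then have "terminal_time L y 0" unfolding terminal_time_def by (simp only:) simp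
    with \<open>0 \<le> T\<close> show ?thesis by blast
  next
    case True
    then obtain i j :: 'n where "i \<noteq> j" by blast
    \<comment> \<open>A nonzero vector orthogonal to \<omega>, supported on two nodes; it certifies
      that the minima in \<open>lambda_restricted\<close> exist.\<close>
    define z :: "real^'n" where "z = \<omega> $ j *\<^sub>R axis i 1 - \<omega> $ i *\<^sub>R axis j 1"
    have "z $ i = \<omega> $ j" using \<open>i \<noteq> j\<close> by (simp add: z_def axis_def)
    with \<omega>[of j] have "z \<noteq> 0" by auto
    moreover have "z \<bullet> \<omega> = 0"
      by (simp add: z_def inner_diff_left inner_axis inner_commute[of "axis _ _"])
    ultimately have z: "z \<noteq> 0" "z \<bullet> \<omega> = 0" .
    have C_pos: "0 < C \<gamma>" for \<gamma>
      using lambda_restricted_weight_root_pos[OF assms(8,7) z, of \<gamma>] Max_weight_pos[of \<omega>, OF \<omega>]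
      by (simp add: C_def)
    then have pos: "0 < C \<alpha>" "0 < b" by (simp_all add: b_def)
    have cont: "continuous_on {0..L} (\<lambda>x. y i x t)" if "0 < t" for i t
      using that by (intro continuous_on_slice[OF closed_loop_continuous[OF cl]]) simp
    define W where "W t = disagreement_energy \<omega> L (\<lambda>i x. y i x t)" for t
    obtain E where E: "countable E"
      "\<And>t. 0 < t \<Longrightarrow> t \<notin> E \<Longrightarrow> \<exists>d. (W has_real_derivative d) (at t)
        \<and> d \<le> - dissipation \<omega> A L \<alpha> (\<lambda>i x. y i x t) - dissipation \<omega> A L \<beta> (\<lambda>i x. y i x t)"
      using closed_loop_energy[OF assms(4,5,8) cl] unfolding W_def by blast
    have "W T = 0"
      unfolding T_def
    proof (rule fixed_time_extinction[OF pos assms(2,3) _ _ E(1)])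
      show "continuous_on {0<..} W"
        unfolding W_def by (rule closed_loop_energy_continuous[OF cl])
      show "0 \<le> W t" if "0 < t" for t
        unfolding W_def by (rule disagreement_energy_nonneg[OF \<omega> cont[OF that]])
      fix t assume t: "0 < t" "t \<notin> E"
      note bounds = dissipation_ge_energy_powr[where v = "\<lambda>i x. y i x t", OF assms(6,8,7) z cont[OF t(1)]]
      have "C \<alpha> * W t powr \<alpha> \<le> dissipation \<omega> A L \<alpha> (\<lambda>i x. y i x t)"
        unfolding C_def W_def by (rule bounds(1)[OF assms(1,2)])
      moreover have "b * W t powr \<beta> \<le> dissipation \<omega> A L \<beta> (\<lambda>i x. y i x t)"
        unfolding b_def C_def W_def by (rule bounds(2)[OF assms(3)])
      ultimately show "\<exists>d. (W has_real_derivative d) (at t)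
          \<and> d \<le> - C \<alpha> * W t powr \<alpha> - b * W t powr \<beta>"
        using E(2)[OF t] by fastforce
    qed
    moreover have "0 < T" using pos assms(2,3) by (simp add: T_def add_pos_pos)
    ultimately have "terminal_time L y T"
      unfolding W_def
      by (intro terminal_time_if_agree[OF cl] disagreement_energy_eq_0D[OF \<omega> cont assms(4)])
    then show ?thesis by blast
  qed
  have "fixed_time_consensus L (closed_loop k L \<alpha> \<beta> A)"
    unfolding fixed_time_consensus_def finite_time_consensus_def
  \<comment> \<open>The definition asks for a positive bound, but for a single node \<open>T\<close>
    is only known to be nonnegative. The sharp bound \<open>T\<close> is stated separately.\<close>
  proof (intro conjI exI[of _ "T + 1"])
    show "0 < T + 1" using \<open>0 \<le> T\<close> by simp
    show "\<forall>y0 y. closed_loop k L \<alpha> \<beta> A y0 y \<longrightarrow> (\<exists>t'. terminal_time L y t' \<and> t' \<le> T + 1)"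
      using main by (meson add_increasing2 zero_le_one)
    show "\<forall>y0 y. closed_loop k L \<alpha> \<beta> A y0 y \<longrightarrow> (\<exists>t'. terminal_time L y t')"
      using main by meson
  qed
  moreover have "\<forall>y0 y. closed_loop k L \<alpha> \<beta> A y0 y \<longrightarrow> (\<exists>t'. terminal_time L y t' \<and> t' \<le> T)"
    using main by simp
  ultimately show ?thesis
    unfolding Let_def T_def b_def C_def weight_root_def by (rule conjI)
qed

end
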